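(* Let $k\ge2$ be an integer and let $B_{i,j}:=2\min(i,j)$ for $1\le i,j\le k$. Let $(Q_1,\dots,Q_k)$ denote the unique solution with all $Q_i\in(0,1)$ of the system $$1-Q_i=\prod_{j=1}^kQ_j^{B_{i,j}}\quad(1\le i\le k-1),\qquad(1-Q_k)^2=\prod_{j=1}^kQ_j^{B_{k,j}}.$$ Then $$2\bigl(L(1)-L(Q_k)\bigr)+\sum_{r=1}^{k-1}\bigl(L(1)-L(Q_r)\bigr)=\frac{\pi^2}{6}.$$
   Context: $L$ denotes Rogers' dilogarithm function: $L(x):=\mathrm{Li}_2(x)+\frac12\log(x)\log(1-x)$ for $x\in(0,1)$, where $\mathrm{Li}_2(x)=\sum_{n\ge1}\frac{x^n}{n^2}$, extended by $L(0)=0$ and $L(1)=\frac{\pi^2}{6}$. *)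

theory Defs
  imports "HOL-Analysis.Analysis"
begin

text \<open>The power series converges for \<open>\<bar>x\<bar> \<le> 1\<close>; the summation index is shifted so that it starts at 0.\<close>

definition Li2 :: "real \<Rightarrow> real" where
  "Li2 x = (\<Sum>n. x ^ Suc n / (real (Suc n))\<^sup>2)"

text \<open>Only the values on \<open>[0, 1]\<close> are meaningful.\<close>

definition rogers_L :: "real \<Rightarrow> real" where
  "rogers_L x =
     (if x = 0 then 0
      else if x = 1 then pi\<^sup>2 / 6
      else Li2 x + 1 / 2 * ln x * ln (1 - x))"

definition B :: "nat \<Rightarrow> nat \<Rightarrow> nat" where
  "B i j = 2 * min i j"

text \<open>
  A tuple \<open>(Q\<^sub>1, \<dots>, Q\<^sub>k)\<close> is an extensional function on \<open>{1..k}\<close>, so that equality of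
  tuples is equality of functions and uniqueness of a solution can be stated by \<open>\<exists>!\<close>.
\<close>

definition is_solution :: "nat \<Rightarrow> (nat \<Rightarrow> real) \<Rightarrow> bool" where
  "is_solution k Q \<longleftrightarrow>
     Q \<in> {1..k} \<rightarrow>\<^sub>E {0<..<1} \<and>
     (\<forall>i\<in>{1..k-1}. 1 - Q i = (\<Prod>j=1..k. Q j ^ B i j)) \<and>
     (1 - Q k)\<^sup>2 = (\<Prod>j=1..k. Q j ^ B k j)"

end

theory Submission
  imports Defs "HOL-Real_Asymp.Real_Asymp"
begin

text \<open>
  The system has the explicit solution \<open>Q\<^sub>i = 1 - 1/(i+1)\<^sup>2\<close> for \<open>i < k\<close> and \<open>Q\<^sub>k = k/(k+1)\<close>.
  To see that it is the only one, put \<open>u\<^sub>i = \<Prod>\<^sub>j Q\<^sub>j\<^bsup>-min(i,j)\<^esup>\<close>. The equations become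
  \<open>u\<^sub>0 = 1\<close>, \<open>u\<^sub>i\<^sub>-\<^sub>1 u\<^sub>i\<^sub>+\<^sub>1 = u\<^sub>i\<^sup>2 - 1\<close> for \<open>0 < i < k\<close>, and \<open>u\<^sub>k - u\<^sub>k\<^sub>-\<^sub>1 = 1\<close>. The quadratic recurrence
  linearises to \<open>u\<^sub>i\<^sub>-\<^sub>1 + u\<^sub>i\<^sub>+\<^sub>1 = u\<^sub>1 u\<^sub>i\<close>, so for positive \<open>u\<close> the differences \<open>u\<^sub>i\<^sub>+\<^sub>1 - u\<^sub>i\<close> all exceed
  \<open>1\<close> when \<open>u\<^sub>1 > 2\<close> and are all below \<open>1\<close> when \<open>u\<^sub>1 < 2\<close>. Hence \<open>u\<^sub>1 = 2\<close> and \<open>u\<^sub>i = i + 1\<close>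
  (lemma \<open>quadratic_recurrence_unique\<close>).

  By Euler's reflection formula \<open>L(x) + L(1 - x) = L(1)\<close> the left-hand side equals
  \<open>2 L(1/(k+1)) + \<Sum>\<^sub>r\<^sub><\<^sub>k L(1/(r+1)\<^sup>2)\<close>. Abel's duplication formula
  \<open>L(x\<^sup>2) = 2 L(x) - 2 L(x/(1+x))\<close> at \<open>x = 1/(r+1)\<close> makes the sum telescope, and what remains is
  \<open>2 L(1/2) = L(1) = \<pi>\<^sup>2/6\<close>. Both functional equations hold because \<open>L\<close> is continuous on
  \<open>[0, 1]\<close> and the derivatives of the two sides agree on \<open>(0, 1)\<close>.
\<close>

section \<open>Analytic properties of Rogers' dilogarithm\<close>

lemma Li2_0 [simp]: "Li2 0 = 0"
  by (simp add: Li2_def)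

lemma Li2_1: "Li2 1 = pi\<^sup>2 / 6"
  using inverse_squares_sums by (simp add: Li2_def sums_iff add.commute)

text \<open>
  Since \<open>ln 0 = 0\<close> holds by convention, the general formula also gives the values at \<open>0\<close> and \<open>1\<close>.
\<close>

lemma rogers_L_eq: "rogers_L x = Li2 x + ln x * ln (1 - x) / 2"
  by (simp add: rogers_L_def Li2_1)

lemma continuous_on_Li2: "continuous_on {0..1} Li2"
proof -
  have s: "summable (\<lambda>n. 1 / (real (Suc n))\<^sup>2)"
    using inverse_squares_sums by (simp add: sums_iff add.commute)
  have "uniform_limit {0..1} (\<lambda>n x. \<Sum>i<n. x ^ Suc i / (real (Suc i))\<^sup>2) Li2 sequentially"
    unfolding Li2_def
    by (rule Weierstrass_m_test[OF _ s])
      (auto simp: norm_divide norm_mult norm_power divide_simps mult_le_one power_le_one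
        simp del: power_Suc)
  then show ?thesis
    by (rule uniform_limit_theorem[rotated]) (auto intro!: always_eventually continuous_intros)
qed

lemma DERIV_Li2:
  assumes "0 < x" "x < 1"
  shows "(Li2 has_real_derivative - ln (1 - x) / x) (at x)"
proof -
  have "DERIV (\<lambda>x. \<Sum>n. 1 / (real (Suc n))\<^sup>2 * x ^ Suc n) x :>
      (\<Sum>n. 1 / (real (Suc n))\<^sup>2 * real (Suc n) * x ^ n)"
  proof (rule DERIV_power_series'[where R = 1])
    fix y :: real assume y: "y \<in> {-1<..<1}"
    then have "summable (\<lambda>n. norm y ^ n)" by (intro summable_geometric) auto
    then show "summable (\<lambda>n. 1 / (real (Suc n))\<^sup>2 * real (Suc n) * y ^ n)"
      by (rule summable_comparison_test'[where N = 0])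
        (auto simp: norm_mult norm_divide norm_power power2_eq_square divide_simps
          power_abs mult_le_cancel_left1 simp del: of_nat_Suc)
  qed (use assms in auto)
  moreover have "(\<lambda>n. 1 / (real (Suc n))\<^sup>2 * real (Suc n) * x ^ n) sums (- ln (1 - x) / x)"
  proof -
    have "(\<lambda>n. - (x ^ n) / real n) sums ln (1 - x)"
      using ln_series'[of "- x"] assms by simp
    then have "(\<lambda>n. - (x ^ Suc n) / real (Suc n)) sums ln (1 - x)"
      by (subst sums_Suc_iff) simp
    from sums_divide[OF sums_minus[OF this], of x] show ?thesis
      using assms by (simp add: power2_eq_square divide_simps del: of_nat_Suc)
  qed
  ultimately show ?thesis
    by (simp add: Li2_def[abs_def] sums_iff)
qed

lemma DERIV_rogers_L:
  assumes "0 < x" "x < 1"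
  shows "(rogers_L has_real_derivative - (ln (1 - x) / x + ln x / (1 - x)) / 2) (at x)"
  unfolding rogers_L_eq[abs_def]
  by (rule derivative_eq_intros DERIV_Li2 refl | use assms in \<open>simp add: field_simps\<close>)+

lemma continuous_on_rogers_L: "continuous_on {0..1} rogers_L"
proof -
  have "((\<lambda>x::real. ln x * ln (1 - x)) \<longlongrightarrow> ln x * ln (1 - x)) (at x within {0..1})"
    if x: "x \<in> {0..1}" for x
  proof -
    consider "x = 0" | "x = 1" | "0 < x" "x < 1"
      using x by (cases "x = 0 \<or> x = 1") auto
    then show ?thesis
    proof cases
      case 1
      have "((\<lambda>x::real. ln x * ln (1 - x)) \<longlongrightarrow> 0) (at_right 0)"
        by real_asymp
      then show ?thesis
        using 1 by (simp add: at_within_Icc_at_right)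
    next
      case 2
      have "((\<lambda>x::real. ln x * ln (1 - x)) \<longlongrightarrow> 0) (at_left 1)"
        by real_asymp
      then show ?thesis
        using 2 by (simp add: at_within_Icc_at_left)
    next
      case 3
      then show ?thesis
        by (intro tendsto_intros) auto
    qed
  qed
  then have "continuous_on {0..1} (\<lambda>x::real. ln x * ln (1 - x))"
    by (simp add: continuous_on_def)
  then show ?thesis
    unfolding rogers_L_eq[abs_def]
    by (intro continuous_on_add continuous_on_divide continuous_on_const continuous_on_Li2) auto
qed

section \<open>Functional equations\<close>

lemma constant_on_unit_interval:
  fixes f :: "real \<Rightarrow> real"
  assumes "continuous_on {0..1} f"
    and "\<And>x. 0 < x \<Longrightarrow> x < 1 \<Longrightarrow> (f has_real_derivative 0) (at x)"
    and "0 \<le> x" "x \<le> 1"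
  shows "f x = f 0"
  using DERIV_isconst2[of 0 1 f x] assms by auto

text \<open>Euler's reflection formula.\<close>

lemma rogers_L_reflection:
  assumes "0 \<le> x" "x \<le> 1"
  shows "rogers_L x + rogers_L (1 - x) = rogers_L 1"
proof -
  have "rogers_L x + rogers_L (1 - x) = rogers_L 0 + rogers_L (1 - 0)"
  proof (rule constant_on_unit_interval[where f = "\<lambda>x. rogers_L x + rogers_L (1 - x)"])
    show "continuous_on {0..1} (\<lambda>x. rogers_L x + rogers_L (1 - x))"
      by (intro continuous_intros continuous_on_rogers_L
          continuous_on_compose2[OF continuous_on_rogers_L]) auto
    show "((\<lambda>x. rogers_L x + rogers_L (1 - x)) has_real_derivative 0) (at x)"
      if x: "0 < x" "x < 1" for x
      by (rule derivative_eq_intros DERIV_rogers_L DERIV_chain2[OF DERIV_rogers_L] refl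
          | use x in \<open>simp add: field_simps\<close>)+
  qed (use assms in auto)
  then show ?thesis
    by (simp add: rogers_L_def)
qed

text \<open>Abel's duplication formula.\<close>

lemma rogers_L_duplication:
  assumes "0 \<le> x" "x \<le> 1"
  shows "rogers_L (x\<^sup>2) = 2 * rogers_L x - 2 * rogers_L (x / (1 + x))"
proof -
  let ?G = "\<lambda>x. rogers_L (x\<^sup>2) - 2 * rogers_L x + 2 * rogers_L (x / (1 + x))"
  have "?G x = ?G 0"
  proof (rule constant_on_unit_interval[where f = ?G])
    show "continuous_on {0..1} ?G"
      by (intro continuous_intros continuous_on_rogers_L
          continuous_on_compose2[OF continuous_on_rogers_L]) (auto simp: power_le_one)
    show "(?G has_real_derivative 0) (at x)" if x: "0 < x" "x < 1" for x
    proof -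
      have sq: "0 < x\<^sup>2" "x\<^sup>2 < 1"
        using x by (auto simp: power_less_one_iff)
      have fr: "0 < x / (1 + x)" "x / (1 + x) < 1"
        using x by auto
      have lns: "ln (1 - x\<^sup>2) = ln (1 - x) + ln (1 + x)" "ln (x\<^sup>2) = 2 * ln x"
        "ln (x / (1 + x)) = ln x - ln (1 + x)" "ln (1 - x / (1 + x)) = - ln (1 + x)"
      proof -
        have "1 - x\<^sup>2 = (1 - x) * (1 + x)" by (simp add: power2_eq_square algebra_simps)
        then show "ln (1 - x\<^sup>2) = ln (1 - x) + ln (1 + x)"
          using x by (simp add: ln_mult)
        show "ln (x\<^sup>2) = 2 * ln x"
          using x by (simp add: ln_realpow)
        show "ln (x / (1 + x)) = ln x - ln (1 + x)"
          using x by (simp add: ln_div)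
        have "1 - x / (1 + x) = 1 / (1 + x)"
          using x by (simp add: field_simps)
        then show "ln (1 - x / (1 + x)) = - ln (1 + x)"
          using x by (simp add: ln_div)
      qed
      have d1: "((\<lambda>x. x\<^sup>2) has_real_derivative 2 * x) (at x)"
        by (auto intro!: derivative_eq_intros)
      have d2: "((\<lambda>x. x / (1 + x)) has_real_derivative 1 / (1 + x)\<^sup>2) (at x)"
        using x by (auto intro!: derivative_eq_intros simp: power2_eq_square field_simps)
      have "(?G has_real_derivative
          - (ln (1 - x\<^sup>2) / x\<^sup>2 + ln (x\<^sup>2) / (1 - x\<^sup>2)) / 2 * (2 * x)
          - 2 * (- (ln (1 - x) / x + ln x / (1 - x)) / 2)
          + 2 * (- (ln (1 - x / (1 + x)) / (x / (1 + x))
                  + ln (x / (1 + x)) / (1 - x / (1 + x))) / 2 * (1 / (1 + x)\<^sup>2))) (at x)"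
        by (intro DERIV_add DERIV_diff DERIV_cmult DERIV_chain2[OF DERIV_rogers_L d1]
            DERIV_chain2[OF DERIV_rogers_L d2] DERIV_rogers_L x sq fr)
      also have "- (ln (1 - x\<^sup>2) / x\<^sup>2 + ln (x\<^sup>2) / (1 - x\<^sup>2)) / 2 * (2 * x)
          - 2 * (- (ln (1 - x) / x + ln x / (1 - x)) / 2)
          + 2 * (- (ln (1 - x / (1 + x)) / (x / (1 + x))
                  + ln (x / (1 + x)) / (1 - x / (1 + x))) / 2 * (1 / (1 + x)\<^sup>2)) = 0"
      proof -
        define a b c where "a = ln x" "b = ln (1 - x)" "c = ln (1 + x)"
        have e: "1 - x / (1 + x) = 1 / (1 + x)" "1 - x\<^sup>2 = (1 - x) * (1 + x)"
          using x by (simp_all add: field_simps power2_eq_square)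
        have nz: "x \<noteq> 0" "1 - x \<noteq> 0" "1 + x \<noteq> 0"
          using x by auto
        show ?thesis
          unfolding lns unfolding e a_b_c_def[symmetric]
          using nz by (simp add: divide_simps) (simp add: algebra_simps power2_eq_square)
      qed
      finally show ?thesis .
    qed
  qed (use assms in auto)
  then show ?thesis
    by (simp add: rogers_L_def)
qed

section \<open>Solving the system\<close>

text \<open>
  The quadratic recurrence leaves \<open>u 1\<close> free; positivity together with the condition on the last
  difference forces \<open>u 1 = 2\<close>.
\<close>

lemma quadratic_recurrence_unique:
  fixes u :: "nat \<Rightarrow> real"
  assumes "k \<ge> 1" and u0: "u 0 = 1"
    and pos: "\<And>i. i \<le> k \<Longrightarrow> u i > 0"
    and rec: "\<And>i. i + 2 \<le> k \<Longrightarrow> u (i + 2) * u i = (u (i + 1))\<^sup>2 - 1"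
    and last: "u k - u (k - 1) = 1"
    and "i \<le> k"
  shows "u i = real i + 1"
proof -
  define s where "s = u 1"
  have lin: "u (i + 2) + u i = s * u (i + 1)" if "i + 2 \<le> k" for i
    using that
  proof (induction i)
    case 0
    then show ?case
      using rec[of 0] u0 by (simp add: s_def power2_eq_square)
  next
    case (Suc i)
    \<comment> \<open>Subtracting the recurrence at \<open>i\<close> from the one at \<open>i + 1\<close> cancels the constant \<open>1\<close>.\<close>
    have "(u (i + 3) + u (i + 1)) * u (i + 1) = u (i + 2) * (u (i + 2) + u i)"
      using rec[of i] rec[of "Suc i"] Suc.prems
      by (simp add: algebra_simps power2_eq_square numeral_eq_Suc)
    also have "\<dots> = u (i + 2) * (s * u (i + 1))"
      using Suc by simp
    finally have "u (i + 3) + u (i + 1) = s * u (i + 2)"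
      using pos[of "i + 1"] Suc.prems by simp
    then show ?case
      by (simp add: numeral_eq_Suc)
  qed
  have step: "u (i + 2) - u (i + 1) = u (i + 1) - u i + (s - 2) * u (i + 1)" if "i + 2 \<le> k" for i
    using lin[OF that] by (simp add: algebra_simps)
  have gt: "u (Suc i) - u i > 1" if "s > 2" "i + 1 \<le> k" for i
    using that(2)
  proof (induction i)
    case 0
    then show ?case
      using that u0 by (simp add: s_def)
  next
    case (Suc i)
    have "(s - 2) * u (i + 1) > 0"
      using pos[of "i + 1"] that(1) Suc.prems by simp
    then show ?case
      using Suc step[of i] by simp
  qed
  have lt: "u (Suc i) - u i < 1" if "s < 2" "i + 1 \<le> k" for i
    using that(2)
  proof (induction i)
    case 0
    then show ?case
      using that u0 by (simp add: s_def)
  next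
    case (Suc i)
    have "(s - 2) * u (i + 1) < 0"
      using pos[of "i + 1"] that(1) Suc.prems by (simp add: mult_neg_pos)
    then show ?case
      using Suc step[of i] by simp
  qed
  have "s = 2"
    using gt[of "k - 1"] lt[of "k - 1"] last \<open>k \<ge> 1\<close> by fastforce
  have diff: "u (Suc i) - u i = 1" if "i + 1 \<le> k" for i
    using that
  proof (induction i)
    case 0
    then show ?case
      using u0 \<open>s = 2\<close> by (simp add: s_def)
  next
    case (Suc i)
    then show ?case
      using step[of i] \<open>s = 2\<close> by simp
  qed
  show ?thesis
    using \<open>i \<le> k\<close>
  proof (induction i)
    case (Suc i)
    then show ?case
      using diff[of i] by simp
  qed (simp add: u0)
qed

text \<open>
  The square root of the right-hand side of the \<open>i\<close>-th equation; the index \<open>0\<close> is allowed and gives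
  the empty product \<open>1\<close>.
\<close>

definition root_rhs :: "nat \<Rightarrow> (nat \<Rightarrow> real) \<Rightarrow> nat \<Rightarrow> real" where
  "root_rhs k Q i = (\<Prod>j=1..k. Q j ^ min i j)"

lemma root_rhs_0 [simp]: "root_rhs k Q 0 = 1"
  by (simp add: root_rhs_def)

lemma root_rhs_squared: "(\<Prod>j=1..k. Q j ^ B i j) = (root_rhs k Q i)\<^sup>2"
  by (simp add: root_rhs_def B_def prod_power_distrib power_mult[symmetric] mult.commute)

lemma root_rhs_Suc: "root_rhs k Q (Suc i) = root_rhs k Q i * (\<Prod>j=Suc i..k. Q j)"
proof -
  have "(\<Prod>j=Suc i..k. Q j) = (\<Prod>j=1..k. if j \<in> {Suc i..k} then Q j else 1)"
    by (subst prod.inter_restrict[symmetric]) (auto intro!: prod.cong)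
  then have "root_rhs k Q i * (\<Prod>j=Suc i..k. Q j) =
      (\<Prod>j=1..k. Q j ^ min i j * (if j \<in> {Suc i..k} then Q j else 1))"
    by (simp add: root_rhs_def prod.distrib)
  also have "\<dots> = root_rhs k Q (Suc i)"
    unfolding root_rhs_def by (intro prod.cong refl) (auto simp: min_def not_less_eq_eq)
  finally show ?thesis ..
qed

lemma root_rhs_pos:
  assumes "\<And>j. j \<in> {1..k} \<Longrightarrow> Q j > 0"
  shows "root_rhs k Q i > 0"
  unfolding root_rhs_def using assms by (intro prod_pos) auto

lemma is_solution_iff:
  "is_solution k Q \<longleftrightarrow> Q \<in> {1..k} \<rightarrow>\<^sub>E {0<..<1} \<and>
     (\<forall>i\<in>{1..k-1}. 1 - Q i = (root_rhs k Q i)\<^sup>2) \<and> (1 - Q k)\<^sup>2 = (root_rhs k Q k)\<^sup>2"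
  unfolding is_solution_def root_rhs_squared ..

text \<open>
  The solution \<open>Q\<^sub>i = 1 - 1/(i+1)\<^sup>2\<close> for \<open>i < k\<close>, \<open>Q\<^sub>k = k/(k+1)\<close>. It is written with differences from
  \<open>1\<close> to fit the equations and the reflection formula, and restricted to \<open>{1..k}\<close> to be extensional.
\<close>

definition explicit_solution :: "nat \<Rightarrow> nat \<Rightarrow> real" where
  "explicit_solution k = (\<lambda>i\<in>{1..k}. if i < k then 1 - 1 / (real i + 1)\<^sup>2 else 1 - 1 / (real k + 1))"

lemma solution_unique:
  assumes "k \<ge> 1" and sol: "is_solution k Q"
  shows "Q = explicit_solution k"
proof -
  have Q: "Q \<in> {1..k} \<rightarrow>\<^sub>E {0<..<1}"
    and eq: "\<And>i. 1 \<le> i \<Longrightarrow> i < k \<Longrightarrow> 1 - Q i = (root_rhs k Q i)\<^sup>2"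
    and eqk: "(1 - Q k)\<^sup>2 = (root_rhs k Q k)\<^sup>2"
    using sol by (auto simp: is_solution_iff)
  have Q01: "0 < Q i" "Q i < 1" if "i \<in> {1..k}" for i
    using PiE_mem[OF Q that] by auto
  define u where "u i = 1 / root_rhs k Q i" for i
  have pos: "root_rhs k Q i > 0" for i
    using Q01 by (intro root_rhs_pos) auto
  have eqk': "root_rhs k Q k = 1 - Q k"
    using eqk pos[of k] Q01[of k] \<open>k \<ge> 1\<close> by (simp add: power2_eq_iff)
  \<comment> \<open>\<open>T i = u i / u (i + 1)\<close> and \<open>Q (i + 1) = T i / T (i + 1)\<close>, so \<open>Q\<close> is expressed by \<open>u\<close> alone.\<close>
  define T where "T i = (\<Prod>j=Suc i..k. Q j)" for i
  have T_pos: "T i > 0" for i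
    unfolding T_def using Q01 by (intro prod_pos) auto
  have T_rec: "T i = Q (Suc i) * T (Suc i)" if "i < k" for i
    unfolding T_def using that by (subst prod.atLeast_Suc_atMost) auto
  have u_Suc: "u i = u (Suc i) * T i" for i
    using T_pos[of i] by (simp add: u_def root_rhs_Suc flip: T_def)
  have u_eq: "u i = real i + 1" if "i \<le> k" for i
  proof (rule quadratic_recurrence_unique[where k = k and u = u])
    fix i assume i: "i + 2 \<le> k"
    have "u (i + 2) * u i * T (Suc i) = u (Suc i) * T i * u (Suc i)"
      using u_Suc[of i] u_Suc[of "Suc i"] by (simp add: mult_ac)
    also have "\<dots> = (u (Suc i))\<^sup>2 * Q (Suc i) * T (Suc i)"
      using T_rec[of i] i by (simp add: power2_eq_square)
    finally have "u (i + 2) * u i = (u (Suc i))\<^sup>2 * Q (Suc i)"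
      using T_pos[of "Suc i"] by simp
    also have "Q (Suc i) = 1 - (root_rhs k Q (Suc i))\<^sup>2"
      using eq[of "Suc i"] i by simp
    finally show "u (i + 2) * u i = (u (i + 1))\<^sup>2 - 1"
      using pos[of "Suc i"] by (simp add: u_def field_simps power2_eq_square)
  next
    have "T (k - 1) = Q k"
      using T_rec[of "k - 1"] \<open>k \<ge> 1\<close> by (simp add: T_def)
    then have "u (k - 1) = u k * Q k"
      using u_Suc[of "k - 1"] \<open>k \<ge> 1\<close> by simp
    moreover have "u k * (1 - Q k) = 1"
      using eqk' pos[of k] by (simp add: u_def)
    ultimately show "u k - u (k - 1) = 1"
      by (simp only: right_diff_distrib mult_1_right)
  qed (use \<open>k \<ge> 1\<close> that pos in \<open>auto simp: u_def\<close>)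
  have P_eq: "root_rhs k Q i = 1 / (real i + 1)" if "i \<le> k" for i
    using u_eq[OF that] pos[of i] by (simp add: u_def field_simps)
  show ?thesis
  proof
    fix i
    show "Q i = explicit_solution k i"
    proof (cases "i \<in> {1..k}")
      case False
      then show ?thesis
        using PiE_arb[OF Q False] False unfolding explicit_solution_def
        by (simp only: restrict_apply if_False)
    next
      case True
      show ?thesis
      proof (cases "i = k")
        case True
        have "Q k = 1 - 1 / (real k + 1)"
          using eqk' P_eq[OF order_refl] by linarith
        then show ?thesis
          using True \<open>k \<ge> 1\<close> by (simp add: explicit_solution_def)
      next
        case False
        then have i: "1 \<le> i" "i < k"
          using \<open>i \<in> {1..k}\<close> by auto
        have "Q i = 1 - (1 / (real i + 1))\<^sup>2"
          using eq[OF i] unfolding P_eq[OF less_imp_le[OF i(2)]] by linarith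
        then show ?thesis
          using i by (simp add: explicit_solution_def power_one_over)
      qed
    qed
  qed
qed

lemma prod_explicit_solution:
  assumes "i < k"
  shows "(\<Prod>j=Suc i..k. explicit_solution k j) = (real i + 1) / (real i + 2)"
  using assms
proof (induction "k - Suc i" arbitrary: i)
  case 0
  then have "k = Suc i" by simp
  then show ?case
    by (simp add: explicit_solution_def field_simps)
next
  case (Suc n)
  then have "Suc i < k" by simp
  have "(\<Prod>j=Suc i..k. explicit_solution k j) =
      explicit_solution k (Suc i) * (\<Prod>j=Suc (Suc i)..k. explicit_solution k j)"
    using Suc.prems by (subst prod.atLeast_Suc_atMost) auto
  also have "\<dots> = (1 - 1 / (real i + 2)\<^sup>2) * ((real i + 2) / (real i + 3))"
    using Suc.hyps(1)[of "Suc i"] Suc.hyps(2) \<open>Suc i < k\<close>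
    by (simp add: explicit_solution_def add_ac)
  also have "1 - 1 / (real i + 2)\<^sup>2 = (real i + 1) * (real i + 3) / (real i + 2)\<^sup>2"
    by (simp add: divide_simps) (simp add: algebra_simps power2_eq_square)
  finally show ?case
    by (simp add: power2_eq_square)
qed

lemma root_rhs_explicit_solution:
  assumes "i \<le> k"
  shows "root_rhs k (explicit_solution k) i = 1 / (real i + 1)"
  using assms
proof (induction i)
  case (Suc i)
  then show ?case
    using prod_explicit_solution[of i k] by (simp add: root_rhs_Suc add_ac)
qed simp

lemma is_solution_explicit_solution:
  assumes "k \<ge> 1"
  shows "is_solution k (explicit_solution k)"
  unfolding is_solution_iff
proof (intro conjI ballI)
  show "explicit_solution k \<in> {1..k} \<rightarrow>\<^sub>E {0<..<1}"
    by (auto simp: explicit_solution_def power_less_one_iff one_less_power)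
  show "1 - explicit_solution k i = (root_rhs k (explicit_solution k) i)\<^sup>2" if "i \<in> {1..k-1}" for i
    using that by (subst root_rhs_explicit_solution) (auto simp: explicit_solution_def power_one_over)
  show "(1 - explicit_solution k k)\<^sup>2 = (root_rhs k (explicit_solution k) k)\<^sup>2"
    using assms by (subst root_rhs_explicit_solution) (auto simp: explicit_solution_def)
qed

section \<open>The dilogarithm identity\<close>

lemma sum_rogers_L_inverse_squares:
  "(\<Sum>r=1..n. rogers_L (1 / (real r + 1)\<^sup>2)) = 2 * rogers_L (1 / 2) - 2 * rogers_L (1 / (real n + 2))"
proof (induction n)
  case (Suc n)
  have "1 / (real n + 2) / (1 + 1 / (real n + 2)) = 1 / (real n + 3)"
    by (simp add: field_simps)
  then have "rogers_L (1 / (real n + 2)\<^sup>2) =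
      2 * rogers_L (1 / (real n + 2)) - 2 * rogers_L (1 / (real n + 3))"
    using rogers_L_duplication[of "1 / (real n + 2)"] by (simp add: power_one_over)
  then show ?case
    using Suc by (simp add: add_ac)
qed simp

theorem proposition6p2:
  fixes k :: nat
  assumes "k \<ge> 2"
  shows "(\<exists>!Q. is_solution k Q) \<and>
    (\<forall>Q. is_solution k Q \<longrightarrow>
       2 * (rogers_L 1 - rogers_L (Q k)) + (\<Sum>r=1..k-1. rogers_L 1 - rogers_L (Q r)) = pi\<^sup>2 / 6)"
proof (intro conjI allI impI)
  show "\<exists>!Q. is_solution k Q"
    using is_solution_explicit_solution[of k] solution_unique[of k] assms by (intro ex1I) auto
next
  fix Q assume "is_solution k Q"
  then have Q: "Q = explicit_solution k"
    using solution_unique assms by simp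
  have reflect: "rogers_L 1 - rogers_L (1 - x) = rogers_L x" if "0 \<le> x" "x \<le> 1" for x
    using rogers_L_reflection[OF that] by simp
  have last_eq: "rogers_L 1 - rogers_L (Q k) = rogers_L (1 / (real k + 1))"
    using assms by (simp add: Q explicit_solution_def reflect)
  have sum_eq: "(\<Sum>r=1..k-1. rogers_L 1 - rogers_L (Q r)) =
      2 * rogers_L (1 / 2) - 2 * rogers_L (1 / (real k + 1))"
  proof -
    have "(\<Sum>r=1..k-1. rogers_L 1 - rogers_L (Q r)) =
        (\<Sum>r=1..k-1. rogers_L (1 / (real r + 1)\<^sup>2))"
    proof (intro sum.cong)
      fix r assume r: "r \<in> {1..k-1}"
      have "rogers_L 1 - rogers_L (Q r) = rogers_L 1 - rogers_L (1 - 1 / (real r + 1)\<^sup>2)"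
        using r assms by (auto simp: Q explicit_solution_def)
      also have "\<dots> = rogers_L (1 / (real r + 1)\<^sup>2)"
        by (rule reflect) auto
      finally show "rogers_L 1 - rogers_L (Q r) = rogers_L (1 / (real r + 1)\<^sup>2)" .
    qed simp
    also have "\<dots> = 2 * rogers_L (1 / 2) - 2 * rogers_L (1 / (real (k - 1) + 2))"
      by (rule sum_rogers_L_inverse_squares)
    also have "real (k - 1) + 2 = real k + 1"
      using assms by simp
    finally show ?thesis .
  qed
  have "2 * (rogers_L 1 - rogers_L (Q k)) + (\<Sum>r=1..k-1. rogers_L 1 - rogers_L (Q r)) =
      2 * rogers_L (1 / 2)"
    unfolding last_eq sum_eq by simp
  also have "\<dots> = pi\<^sup>2 / 6"
    using rogers_L_reflection[of "1 / 2"] by (simp add: rogers_L_def[of 1])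
  finally show
    "2 * (rogers_L 1 - rogers_L (Q k)) + (\<Sum>r=1..k-1. rogers_L 1 - rogers_L (Q r)) = pi\<^sup>2 / 6" .
qed

end
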